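(* Let $n\ge1$, $L\ge1$. Under the choice of rates $x_{a,j}=y_a$ for all $a\in\Sigma$ and all $j\ge1$ (independent of $j$), the stationary distribution of the Markov chain with transition matrix ${}^\nabla\! M^{n,L}$ is Bernoulli with density $$\rho_a=\frac{y_a}{\sum_{b\in\Sigma}y_b}\qquad(a\in\Sigma),$$ i.e. the stationary probability of each word $u=u_1u_2\cdots u_L\in\Sigma^L$ is $\prod_{i=1}^{L}\rho_{u_i}$.
   Context: Let $\Sigma=\{1,\dots,n\}$ and let $\Sigma^L$ be the set of words of length $L$ over $\Sigma$. For a word $u=u_1\cdots u_L$ put $h(u)=u_1\cdots u_{L-1}$ and $t(u)=u_2\cdots u_L$ (the empty word if $L=1$). Given rates $x_{a,k}$ ($a\in\Sigma$, $k\ge1$), for a nonempty word $u$ whose last block (the maximal suffix consisting of repetitions of a single letter) is $a^k$, put $\beta(u)=x_{a,k}$. The matrix $M^{n,L}$, indexed by $\Sigma^L\times\Sigma^L$, has entries $M^{n,L}_{v,u}=\beta(v)$ if $h(v)=t(u)$ and $0$ otherwise: it gives the rate of the transition $u\to v$. For a square matrix $M$, ${}^\nabla\! M$ denotes the matrix obtained from $M$ by subtracting from each diagonal entry the sum of the entries of $M$ in its column. Here the $y_a$ ($a\in\Sigma$) are formal variables, and probabilities are rational functions in them. The stationary distribution is the unique column vector $p=(p(u))_{u\in\Sigma^L}$ with ${}^\nabla\! M^{n,L}p=0$ and $\sum_{u\in\Sigma^L}p(u)=1$. *)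

theory Defs
  imports Complex_Main "HOL-Library.Poly_Mapping" "HOL-Computational_Algebra.Fraction_Field"
begin

text \<open>
  The field of rational functions over the rationals in the formal variables
  \<open>y\<^sub>0, y\<^sub>1, y\<^sub>2, \<dots>\<close>. A monomial is a finitely supported map from variable indices
  to exponents, and a polynomial is a finitely supported map from monomials to
  coefficients. Letters are the elements of \<open>{1..n}\<close>, so the variables of the
  alphabet are \<open>y\<^sub>1, \<dots>, y\<^sub>n\<close>; the others occur in the field but in no rate.
\<close>
type_synonym ratfun = "((nat \<Rightarrow>\<^sub>0 nat) \<Rightarrow>\<^sub>0 rat) fract"

definition yvar :: "nat \<Rightarrow> ratfun" where
  "yvar a = Fraction_Field.Fract (Poly_Mapping.single (Poly_Mapping.single a 1) 1) 1"

definition words :: "nat \<Rightarrow> nat \<Rightarrow> nat list set" where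
  "words n L = {u. length u = L \<and> set u \<subseteq> {1..n}}"

definition last_block_length :: "'a list \<Rightarrow> nat" where
  "last_block_length u = length (takeWhile (\<lambda>c. c = last u) (rev u))"

definition beta :: "(nat \<Rightarrow> nat \<Rightarrow> 'k) \<Rightarrow> nat list \<Rightarrow> 'k" where
  "beta x u = x (last u) (last_block_length u)"

text \<open>
  Matrices indexed by a set \<open>I\<close> are functions \<open>M\<close> of the row index and the column
  index, in this order; only their values on \<open>I\<close> matter. Thus \<open>transition_matrix x v u\<close>
  is the rate of the transition from \<open>u\<close> to \<open>v\<close>.
\<close>
definition transition_matrix ::
    "(nat \<Rightarrow> nat \<Rightarrow> 'k::zero) \<Rightarrow> nat list \<Rightarrow> nat list \<Rightarrow> 'k" where
  "transition_matrix x v u = (if butlast v = tl u then beta x v else 0)"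

definition nabla :: "'i set \<Rightarrow> ('i \<Rightarrow> 'i \<Rightarrow> 'k::ab_group_add) \<Rightarrow> 'i \<Rightarrow> 'i \<Rightarrow> 'k" where
  "nabla I M v u = M v u - (if v = u then \<Sum>w\<in>I. M w u else 0)"

definition stationary :: "'i set \<Rightarrow> ('i \<Rightarrow> 'i \<Rightarrow> 'k::comm_ring_1) \<Rightarrow> ('i \<Rightarrow> 'k) \<Rightarrow> bool" where
  "stationary I Q p \<longleftrightarrow>
     (\<forall>v\<in>I. (\<Sum>u\<in>I. Q v u * p u) = 0) \<and> (\<Sum>u\<in>I. p u) = 1"

end

theory Submission
  imports Defs
begin

text \<open>
  When the rates do not depend on the block length, the balance equation at a word \<open>v\<close> reads
  \<open>p(v) = \<rho>(last v) \<Sum>\<^sub>a p(a h(v))\<close>. Hence the product of the densities is a solution, and applying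
  the equation \<open>L\<close> times to a solution \<open>p\<close> gives \<open>p(u) = \<rho>(u\<^sub>1) \<dots> \<rho>(u\<^sub>L) \<Sum>\<^sub>w p(w)\<close>, the sum being over
  all words of length \<open>L\<close>; this shows uniqueness directly. The argument works
  over any field in which the sum of the rates is not zero.
\<close>

lemma words_0 [simp]: "words n 0 = {[]}"
  by (auto simp: words_def)

lemma Cons_in_words_iff [simp]: "a # w \<in> words n (Suc m) \<longleftrightarrow> a \<in> {1..n} \<and> w \<in> words n m"
  by (auto simp: words_def)

lemma snoc_in_words_iff [simp]: "w @ [b] \<in> words n (Suc m) \<longleftrightarrow> b \<in> {1..n} \<and> w \<in> words n m"
  by (auto simp: words_def)

lemma append_in_words: "v \<in> words n j \<Longrightarrow> w \<in> words n k \<Longrightarrow> v @ w \<in> words n (j + k)"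
  by (auto simp: words_def)

lemma words_SucE_Cons:
  assumes "u \<in> words n (Suc m)"
  obtains a w where "u = a # w" "a \<in> {1..n}" "w \<in> words n m"
  using assms by (cases u) (auto simp: words_def)

lemma words_SucE_snoc:
  assumes "u \<in> words n (Suc m)"
  obtains w b where "u = w @ [b]" "b \<in> {1..n}" "w \<in> words n m"
  using assms by (cases u rule: rev_cases) (auto simp: words_def)

lemma finite_words [simp]: "finite (words n L)"
proof -
  have "words n L = {u. set u \<subseteq> {1..n} \<and> length u = L}"
    by (auto simp: words_def)
  then show ?thesis
    using finite_lists_length_eq[of "{1..n}" L] by simp
qed

text \<open>Splitting off the first letter exposes \<open>tl\<close> and serves for sums along a row
  of the transition matrix; the split at the last letter in \<open>sum_words_snoc\<close> exposes
  \<open>butlast\<close> and serves for columns.\<close>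

lemma sum_words_Cons:
  "(\<Sum>u\<in>words n (Suc m). f u) = (\<Sum>a\<in>{1..n}. \<Sum>w\<in>words n m. f (a # w))"
proof -
  have "bij_betw (\<lambda>(a, w). a # w) ({1..n} \<times> words n m) (words n (Suc m))"
    by (auto simp: bij_betw_def inj_on_def image_iff elim!: words_SucE_Cons)
  from sum.reindex_bij_betw[OF this, of f, symmetric] show ?thesis
    by (simp add: sum.cartesian_product case_prod_unfold)
qed

lemma sum_words_snoc:
  "(\<Sum>u\<in>words n (Suc m). f u) = (\<Sum>b\<in>{1..n}. \<Sum>w\<in>words n m. f (w @ [b]))"
proof -
  have "bij_betw (\<lambda>(b, w). w @ [b]) ({1..n} \<times> words n m) (words n (Suc m))"
    by (auto simp: bij_betw_def inj_on_def image_iff elim!: words_SucE_snoc)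
  from sum.reindex_bij_betw[OF this, of f, symmetric] show ?thesis
    by (simp add: sum.cartesian_product case_prod_unfold)
qed

text \<open>Needed because the rates are prescribed for block lengths \<open>j \<ge> 1\<close>
  only.\<close>

lemma last_block_length_ge_1: "u \<noteq> [] \<Longrightarrow> last_block_length u \<ge> 1"
  by (cases u rule: rev_cases) (auto simp: last_block_length_def)

lemma sum_words_prod_list:
  fixes \<rho> :: "nat \<Rightarrow> 'k::comm_semiring_1"
  assumes "(\<Sum>a\<in>{1..n}. \<rho> a) = 1"
  shows "(\<Sum>u\<in>words n L. prod_list (map \<rho> u)) = 1"
proof (induction L)
  case (Suc L)
  have "(\<Sum>u\<in>words n (Suc L). prod_list (map \<rho> u))
      = (\<Sum>a\<in>{1..n}. \<rho> a * (\<Sum>w\<in>words n L. prod_list (map \<rho> w)))"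
    by (simp add: sum_words_Cons sum_distrib_left)
  then show ?case
    using Suc.IH assms by simp
qed simp

text \<open>Words have length \<open>Suc m\<close>, so \<open>m\<close> is the common length of the
  heads h(v) and tails t(u).\<close>

locale homogeneous_rates =
  fixes n m :: nat and x :: "nat \<Rightarrow> nat \<Rightarrow> 'k::field" and y :: "nat \<Rightarrow> 'k"
  assumes rate: "a \<in> {1..n} \<Longrightarrow> j \<ge> 1 \<Longrightarrow> x a j = y a"
    and sum_rates_nonzero: "(\<Sum>b\<in>{1..n}. y b) \<noteq> 0"
begin

definition density :: "nat \<Rightarrow> 'k" where
  "density a = y a / (\<Sum>b\<in>{1..n}. y b)"

lemma sum_density: "(\<Sum>a\<in>{1..n}. density a) = 1"
  using sum_rates_nonzero by (simp add: density_def flip: sum_divide_distrib)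

lemma beta_snoc: "b \<in> {1..n} \<Longrightarrow> beta x (w @ [b]) = y b"
  using last_block_length_ge_1[of "w @ [b]"] by (simp add: beta_def rate del: One_nat_def)

text \<open>The successors of \<open>u\<close> are the words \<open>tl u @ [b]\<close>, one for each
  letter \<open>b\<close>, entered at rate \<open>y b\<close>; so the total exit rate is the same at
  every word.\<close>

lemma transition_column_sum:
  assumes "u \<in> words n (Suc m)"
  shows "(\<Sum>w\<in>words n (Suc m). transition_matrix x w u) = (\<Sum>b\<in>{1..n}. y b)"
proof -
  have "tl u \<in> words n m"
    using assms by (auto elim: words_SucE_Cons)
  then show ?thesis
    by (simp add: sum_words_snoc transition_matrix_def beta_snoc)
qed

text \<open>The predecessors of \<open>w @ [b]\<close> are the words \<open>a # w\<close>, and all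
  of them enter at the same rate \<open>y b\<close>.\<close>

lemma transition_row_sum:
  assumes "b \<in> {1..n}" "w \<in> words n m"
  shows "(\<Sum>u\<in>words n (Suc m). transition_matrix x (w @ [b]) u * p u)
       = y b * (\<Sum>a\<in>{1..n}. p (a # w))"
  using assms
  by (simp add: sum_words_Cons transition_matrix_def beta_snoc sum_distrib_left if_distrib[of "\<lambda>z. z * _"]
      cong: if_cong)

text \<open>Inflow minus outflow is a row sum minus the constant exit rate times
  \<open>p (w @ [b])\<close>; dividing by that nonzero rate turns \<open>y b\<close> into
  \<open>density b\<close>.\<close>

lemma balance_iff:
  assumes b: "b \<in> {1..n}" and w: "w \<in> words n m"
  shows "(\<Sum>u\<in>words n (Suc m). nabla (words n (Suc m)) (transition_matrix x) (w @ [b]) u * p u) = 0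
     \<longleftrightarrow> p (w @ [b]) = density b * (\<Sum>a\<in>{1..n}. p (a # w))"
proof -
  let ?S = "\<Sum>b\<in>{1..n}. y b" and ?W = "words n (Suc m)"
  have v: "w @ [b] \<in> ?W"
    using b w by simp
  have "(\<Sum>u\<in>?W. nabla ?W (transition_matrix x) (w @ [b]) u * p u)
      = (\<Sum>u\<in>?W. transition_matrix x (w @ [b]) u * p u - (if w @ [b] = u then ?S * p u else 0))"
    by (rule sum.cong) (auto simp: nabla_def transition_column_sum left_diff_distrib)
  also have "\<dots> = y b * (\<Sum>a\<in>{1..n}. p (a # w)) - ?S * p (w @ [b])"
    using v by (simp add: sum_subtractf transition_row_sum[OF b w])
  finally show ?thesis
    using sum_rates_nonzero by (auto simp: density_def field_simps)
qed

lemma stationary_iff: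
  "stationary (words n (Suc m)) (nabla (words n (Suc m)) (transition_matrix x)) p \<longleftrightarrow>
     (\<forall>b\<in>{1..n}. \<forall>w\<in>words n m. p (w @ [b]) = density b * (\<Sum>a\<in>{1..n}. p (a # w))) \<and>
     (\<Sum>u\<in>words n (Suc m). p u) = 1"
proof -
  have "(\<forall>v\<in>words n (Suc m). Q v) \<longleftrightarrow> (\<forall>b\<in>{1..n}. \<forall>w\<in>words n m. Q (w @ [b]))" for Q
    by (metis words_SucE_snoc snoc_in_words_iff)
  then show ?thesis
    by (simp add: stationary_def balance_iff)
qed

text \<open>Each use of the balance equation removes a last letter, leaves its density as a factor
  and puts a summed letter in front. The condition on \<open>j + k\<close> keeps the total length at
  \<open>Suc m\<close>.\<close>

lemma balance_iterate:
  assumes balance: "\<And>b w. b \<in> {1..n} \<Longrightarrow> w \<in> words n m \<Longrightarrow>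
      p (w @ [b]) = density b * (\<Sum>a\<in>{1..n}. p (a # w))"
    and "j + k = Suc m" "w \<in> words n j" "s \<in> words n k"
  shows "p (w @ s) = prod_list (map density s) * (\<Sum>w'\<in>words n k. p (w' @ w))"
  using assms(2-)
proof (induction k arbitrary: j w s)
  case (Suc k)
  obtain b t where s: "s = b # t" "b \<in> {1..n}" "t \<in> words n k"
    using Suc.prems by (auto elim: words_SucE_Cons)
  have step: "p (w' @ w @ [b]) = density b * (\<Sum>a\<in>{1..n}. p (a # w' @ w))"
    if "w' \<in> words n k" for w'
    using balance[OF s(2), of "w' @ w"] append_in_words[OF that Suc.prems(2)] Suc.prems(1)
    by (simp add: add.commute)
  \<comment> \<open>The letter \<open>b\<close> is first moved over to \<open>w\<close>, so that the
    induction hypothesis strips \<open>t\<close> and leaves \<open>b\<close> at the end for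
    \<open>step\<close>.\<close>
  have "p (w @ s) = prod_list (map density t) * (\<Sum>w'\<in>words n k. p (w' @ w @ [b]))"
    using Suc.IH[of "Suc j" "w @ [b]" t] Suc.prems s by simp
  also have "(\<Sum>w'\<in>words n k. p (w' @ w @ [b]))
      = density b * (\<Sum>w'\<in>words n k. \<Sum>a\<in>{1..n}. p (a # w' @ w))"
    by (simp add: step sum_distrib_left)
  also have "(\<Sum>w'\<in>words n k. \<Sum>a\<in>{1..n}. p (a # w' @ w)) = (\<Sum>w'\<in>words n (Suc k). p (w' @ w))"
    by (subst sum.swap) (simp add: sum_words_Cons)
  finally show ?case
    by (simp add: s(1) mult_ac)
qed simp

theorem stationary_iff_Bernoulli:
  "stationary (words n (Suc m)) (nabla (words n (Suc m)) (transition_matrix x)) p \<longleftrightarrow>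
     (\<forall>u\<in>words n (Suc m). p u = prod_list (map density u))"
proof
  assume "stationary (words n (Suc m)) (nabla (words n (Suc m)) (transition_matrix x)) p"
  then have balance: "\<And>b w. b \<in> {1..n} \<Longrightarrow> w \<in> words n m \<Longrightarrow>
        p (w @ [b]) = density b * (\<Sum>a\<in>{1..n}. p (a # w))"
    and total: "(\<Sum>u\<in>words n (Suc m). p u) = 1"
    by (auto simp: stationary_iff)
  show "\<forall>u\<in>words n (Suc m). p u = prod_list (map density u)"
    \<comment> \<open>With an empty prefix the whole word is stripped, and the remaining sum is the
      total mass 1.\<close>
    using balance_iterate[of p 0 "Suc m" "[]", OF balance] total by simp
next
  assume p: "\<forall>u\<in>words n (Suc m). p u = prod_list (map density u)"
  have "p (w @ [b]) = density b * (\<Sum>a\<in>{1..n}. p (a # w))" if "b \<in> {1..n}" "w \<in> words n m" for b w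
  proof -
    have "(\<Sum>a\<in>{1..n}. p (a # w)) = (\<Sum>a\<in>{1..n}. density a) * prod_list (map density w)"
      using p that by (simp add: sum_distrib_right)
    then show ?thesis
      using p that by (simp add: sum_density mult_ac del: One_nat_def)
  qed
  moreover have "(\<Sum>u\<in>words n (Suc m). p u) = 1"
    using p sum_words_prod_list[OF sum_density, of "Suc m"] by simp
  ultimately show "stationary (words n (Suc m)) (nabla (words n (Suc m)) (transition_matrix x)) p"
    by (simp add: stationary_iff)
qed

end

lemma sum_Fract_1: "(\<Sum>a\<in>A. Fraction_Field.Fract (f a) 1) = Fraction_Field.Fract (\<Sum>a\<in>A. f a) 1"
  by (induction A rule: infinite_finite_induct) (auto simp: fract_collapse)

text \<open>Distinct variables are distinct monomials, so the monomial of any \<open>c\<close> in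
  \<open>A\<close> has coefficient 1 in the sum.\<close>

lemma sum_yvar_nonzero:
  assumes "finite A" "A \<noteq> {}"
  shows "(\<Sum>a\<in>A. yvar a) \<noteq> 0"
proof -
  let ?X = "\<lambda>a. Poly_Mapping.single (Poly_Mapping.single a 1) 1 :: (nat \<Rightarrow>\<^sub>0 nat) \<Rightarrow>\<^sub>0 rat"
  obtain c where "c \<in> A"
    using assms by blast
  have single_eq_iff: "Poly_Mapping.single a (1::nat) = Poly_Mapping.single c 1 \<longleftrightarrow> a = c" for a
    by (metis lookup_single_eq lookup_single_not_eq zero_neq_one)
  have "Poly_Mapping.lookup (\<Sum>a\<in>A. ?X a) (Poly_Mapping.single c 1)
      = (\<Sum>a\<in>A. if a = c then 1 else 0)"
    by (simp add: lookup_sum lookup_single when_def single_eq_iff del: One_nat_def)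
  also have "\<dots> = 1"
    using assms \<open>c \<in> A\<close> by simp
  finally have "(\<Sum>a\<in>A. ?X a) \<noteq> 0"
    by auto
  then show ?thesis
    by (simp add: yvar_def sum_Fract_1 Zero_fract_def eq_fract)
qed

theorem corollary13:
  fixes n L :: nat
    and x :: "nat \<Rightarrow> nat \<Rightarrow> ratfun"
    and \<rho> :: "nat \<Rightarrow> ratfun"
    and p :: "nat list \<Rightarrow> ratfun"
  assumes "n \<ge> 1" and "L \<ge> 1"
    and "\<forall>a\<in>{1..n}. \<forall>j\<ge>1. x a j = yvar a"
    and "\<forall>a\<in>{1..n}. \<rho> a = yvar a / (\<Sum>b\<in>{1..n}. yvar b)"
  shows "stationary (words n L) (nabla (words n L) (transition_matrix x)) p \<longleftrightarrow>
           (\<forall>u\<in>words n L. p u = (\<Prod>i<L. \<rho> (u ! i)))"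
proof -
  obtain m where L: "L = Suc m"
    using assms(2) by (cases L) auto
  interpret homogeneous_rates n m x yvar
    using assms sum_yvar_nonzero[of "{1..n}"] by unfold_locales auto
  have "prod_list (map density u) = (\<Prod>i<L. \<rho> (u ! i))" if "u \<in> words n L" for u
  proof -
    \<comment> \<open>The values of \<open>\<rho>\<close> are known on the alphabet only.\<close>
    have "u ! i \<in> {1..n}" if "i < L" for i
      using \<open>u \<in> words n L\<close> that nth_mem[of i u] unfolding words_def by blast
    then show ?thesis
      using that assms(4)
      by (auto simp: prod.list_conv_set_nth words_def density_def lessThan_atLeast0 intro!: prod.cong)
  qed
  then show ?thesis
    using stationary_iff_Bernoulli[of p] by (simp add: L)
qed

end
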